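(* Let $\mathcal{V}$ be a Euclidean Jordan algebra of rank $n$ and let $A\in\mathbb{R}^{n\times n}$. Corresponding to a Jordan frame $\{e_1,e_2,\dots,e_n\}$ in $\mathcal{V}$, consider $\widehat{A}:\mathcal{V}\to\mathcal{V}$, $\widehat{A}:=\sum_{i,j=1}^{n}a_{ij}\,e_i\otimes e_j$. Then the following statements hold: (a) $A$ is copositive (respectively, strictly copositive) on $\mathbb{R}^n_+$ if and only if $\widehat{A}$ is copositive (respectively, strictly copositive) on $\mathcal{V}_+$. (b) $A\in\mathbf{R}_0(\mathbb{R}^n)\Leftrightarrow\widehat{A}\in\mathbf{R}_0(\mathcal{V})$. (c) $A\in\mathbf{R}(\mathbb{R}^n)\Rightarrow\widehat{A}\in\mathbf{R}(\mathcal{V})$. (d) $\widehat{A}\in\mathbf{Q}(\mathcal{V})\Rightarrow A\in\mathbf{Q}(\mathbb{R}^n)$.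
   Context: A Euclidean Jordan algebra is a (nonzero) finite-dimensional real inner product space $(\mathcal{V},\langle\cdot,\cdot\rangle)$ with a bilinear product $(x,y)\mapsto x\circ y$ satisfying $x\circ y=y\circ x$, $x\circ(x^2\circ y)=x^2\circ(x\circ y)$ where $x^2=x\circ x$, and $\langle x\circ y,z\rangle=\langle x,y\circ z\rangle$; it has a unit element $e$. The inner product is taken to be $\langle x,y\rangle=\mathrm{trace}(x\circ y)$, where the trace of an element is the sum of its eigenvalues (from its spectral decomposition). A Jordan frame is a set of mutually orthogonal primitive idempotents with sum $e$; all Jordan frames have the same number of elements, the rank of $\mathcal{V}$; with this inner product a Jordan frame is orthonormal. The symmetric cone is $\mathcal{V}_+=\{x\circ x:x\in\mathcal{V}\}$; $d>0$ means $d$ is in the interior of $\mathcal{V}_+$. For $a,b\in\mathcal{V}$, $(a\otimes b)(x):=\langle b,x\rangle\,a$; thus $\widehat{A}x=\sum_{i}\big(\sum_{j}a_{ij}\langle x,e_j\rangle\big)e_i$. For a linear $L:\mathcal{V}\to\mathcal{V}$ and $q\in\mathcal{V}$, $\mathrm{LCP}(L,\mathcal{V}_+,q)$ is the problem of finding $x\in\mathcal{V}_+$ with $y:=L(x)+q\in\mathcal{V}_+$ and $\langle x,y\rangle=0$. $L\in\mathbf{Q}(\mathcal{V})$ if this has a solution for every $q\in\mathcal{V}$; $L\in\mathbf{R}_0(\mathcal{V})$ if zero is the only solution of $\mathrm{LCP}(L,\mathcal{V}_+,0)$; $L\in\mathbf{R}(\mathcal{V})$ if for some $d>0$ zero is the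 only solution of both $\mathrm{LCP}(L,\mathcal{V}_+,0)$ and $\mathrm{LCP}(L,\mathcal{V}_+,d)$. $L$ is copositive (strictly copositive) on $\mathcal{V}_+$ if $\langle L(x),x\rangle\ge 0$ for all $x\in\mathcal{V}_+$ ($>0$ for all $0\ne x\in\mathcal{V}_+$). The classes $\mathbf{Q}(\mathbb{R}^n)$, $\mathbf{R}_0(\mathbb{R}^n)$, $\mathbf{R}(\mathbb{R}^n)$ and (strict) copositivity on $\mathbb{R}^n_+$ for a matrix $A$ are the same notions with $\mathbb{R}^n$, its usual inner product, and the cone $\mathbb{R}^n_+$ (the nonnegative orthant) in place of $\mathcal{V}$ and $\mathcal{V}_+$. *)

theory Defs
  imports "HOL-Analysis.Analysis"
begin

text \<open>
  The carrier is a type of class \<open>euclidean_space\<close>, i.e. a nonzero finite-dimensional real inner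
  product space. The Jordan product \<open>jp\<close> and the unit \<open>e\<close> are explicit parameters.
\<close>

locale euclidean_jordan_algebra =
  fixes jp :: "'v::euclidean_space \<Rightarrow> 'v \<Rightarrow> 'v" (infixl "\<bullet>\<^sub>J" 70)
    and e :: 'v
  assumes bilinear: "bilinear (\<bullet>\<^sub>J)"
    and commute: "x \<bullet>\<^sub>J y = y \<bullet>\<^sub>J x"
    and jordan_identity: "x \<bullet>\<^sub>J ((x \<bullet>\<^sub>J x) \<bullet>\<^sub>J y) = (x \<bullet>\<^sub>J x) \<bullet>\<^sub>J (x \<bullet>\<^sub>J y)"
    and inner_assoc: "inner (x \<bullet>\<^sub>J y) z = inner x (y \<bullet>\<^sub>J z)"
    and unit: "e \<bullet>\<^sub>J x = x"

definition idempotent :: "('v \<Rightarrow> 'v \<Rightarrow> 'v) \<Rightarrow> 'v \<Rightarrow> bool" where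
  "idempotent jp c \<longleftrightarrow> jp c c = c"

definition primitive_idempotent :: "('v::real_vector \<Rightarrow> 'v \<Rightarrow> 'v) \<Rightarrow> 'v \<Rightarrow> bool" where
  "primitive_idempotent jp c \<longleftrightarrow>
     idempotent jp c \<and> c \<noteq> 0 \<and>
     \<not> (\<exists>a b. idempotent jp a \<and> idempotent jp b \<and> a \<noteq> 0 \<and> b \<noteq> 0 \<and> c = a + b)"

text \<open>
  Orthogonality of idempotents is taken with respect to the Jordan product, so that frames, and
  hence the trace, are defined without reference to the inner product.
\<close>

definition jordan_frame :: "('v::real_vector \<Rightarrow> 'v \<Rightarrow> 'v) \<Rightarrow> 'v \<Rightarrow> 'v set \<Rightarrow> bool" where
  "jordan_frame jp e F \<longleftrightarrow>
     finite F \<and> (\<forall>c\<in>F. primitive_idempotent jp c) \<and>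
     (\<forall>c\<in>F. \<forall>d\<in>F. c \<noteq> d \<longrightarrow> jp c d = 0) \<and> \<Sum>F = e"

text \<open>
  In a Euclidean Jordan algebra the two definite descriptions below are well defined: frames exist
  and are equinumerous, every element has a spectral decomposition, and its eigenvalues, counted
  with multiplicity, do not depend on the frame used.
\<close>

definition jordan_rank :: "('v::real_vector \<Rightarrow> 'v \<Rightarrow> 'v) \<Rightarrow> 'v \<Rightarrow> nat" where
  "jordan_rank jp e = (THE r. \<exists>F. jordan_frame jp e F \<and> card F = r)"

definition jordan_trace :: "('v::real_vector \<Rightarrow> 'v \<Rightarrow> 'v) \<Rightarrow> 'v \<Rightarrow> 'v \<Rightarrow> real" where
  "jordan_trace jp e x =
     (THE t. \<exists>F l. jordan_frame jp e F \<and> x = (\<Sum>c\<in>F. l c *\<^sub>R c) \<and> t = (\<Sum>c\<in>F. l c))"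

locale trace_euclidean_jordan_algebra = euclidean_jordan_algebra +
  assumes inner_eq_trace: "inner x y = jordan_trace (\<bullet>\<^sub>J) e (x \<bullet>\<^sub>J y)"

definition symmetric_cone :: "('v \<Rightarrow> 'v \<Rightarrow> 'v) \<Rightarrow> 'v set" where
  "symmetric_cone jp = {jp x x | x. True}"

definition nonneg_orthant :: "(real ^ 'n) set" where
  "nonneg_orthant = {x. \<forall>i. 0 \<le> x $ i}"

text \<open>
  The complementarity notions are stated for an arbitrary cone \<open>K\<close>, to be used both for a symmetric
  cone and for the nonnegative orthant.
\<close>

definition lcp_solutions :: "('a::real_inner \<Rightarrow> 'a) \<Rightarrow> 'a set \<Rightarrow> 'a \<Rightarrow> 'a set" where
  "lcp_solutions L K q = {x. x \<in> K \<and> L x + q \<in> K \<and> inner x (L x + q) = 0}"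

definition Q_class :: "'a::real_inner set \<Rightarrow> ('a \<Rightarrow> 'a) set" where
  "Q_class K = {L. linear L \<and> (\<forall>q. lcp_solutions L K q \<noteq> {})}"

definition R0_class :: "'a::real_inner set \<Rightarrow> ('a \<Rightarrow> 'a) set" where
  "R0_class K = {L. linear L \<and> lcp_solutions L K 0 = {0}}"

definition R_class :: "'a::real_inner set \<Rightarrow> ('a \<Rightarrow> 'a) set" where
  "R_class K = {L. linear L \<and>
     (\<exists>d\<in>interior K. lcp_solutions L K 0 = {0} \<and> lcp_solutions L K d = {0})}"

definition copositive_on :: "'a::real_inner set \<Rightarrow> ('a \<Rightarrow> 'a) \<Rightarrow> bool" where
  "copositive_on K L \<longleftrightarrow> (\<forall>x\<in>K. inner (L x) x \<ge> 0)"

definition strictly_copositive_on :: "'a::real_inner set \<Rightarrow> ('a \<Rightarrow> 'a) \<Rightarrow> bool" where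
  "strictly_copositive_on K L \<longleftrightarrow> (\<forall>x\<in>K. x \<noteq> 0 \<longrightarrow> inner (L x) x > 0)"

definition rank_one_op :: "'a::real_inner \<Rightarrow> 'a \<Rightarrow> 'a \<Rightarrow> 'a" where
  "rank_one_op a b x = inner b x *\<^sub>R a"

definition frame_lift :: "real ^ 'n ^ 'n \<Rightarrow> ('n \<Rightarrow> 'a) \<Rightarrow> 'a \<Rightarrow> 'a::real_inner" where
  "frame_lift A c x = (\<Sum>i\<in>UNIV. \<Sum>j\<in>UNIV. A $ i $ j *\<^sub>R rank_one_op (c i) (c j) x)"

end

theory Submission
  imports Defs
begin

text \<open>
  Write \<open>D x = (\<langle>x, c\<^sub>i\<rangle>)\<^sub>i\<close> and \<open>D\<^sup>* u = \<Sum>\<^sub>i u\<^sub>i c\<^sub>i\<close>. The frame is orthonormal, so \<open>D \<circ> D\<^sup>*\<close> is the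
  identity and the lift of \<open>A\<close> is \<open>D\<^sup>* \<circ> A \<circ> D\<close>. Since multiplication by an idempotent is positive
  semidefinite, \<open>D\<close> maps the symmetric cone into the orthant, killing no nonzero element, while
  \<open>D\<^sup>* u\<close> lies in the cone exactly when \<open>u\<close> is nonnegative. Solutions of the complementarity problems
  are therefore transported by \<open>D\<close> and \<open>D\<^sup>*\<close>. For the class \<open>\<^bold>R\<close> one also needs that \<open>D\<^sup>*\<close> maps
  interior points to interior points: squaring has the invertible derivative \<open>2 L(a)\<close> at
  \<open>a = \<Sum>\<^sub>i \<surd>u\<^sub>i c\<^sub>i\<close>, hence is open there.
\<close>

section \<open>Positivity of multiplication by an idempotent\<close>

context euclidean_jordan_algebra
begin

sublocale jp: bounded_bilinear "(\<bullet>\<^sub>J)"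
  using bilinear bilinear_conv_bounded_bilinear by blast

text \<open>
  The part of the Jordan identity that is linear in \<open>y\<close>: the cubic part vanishes by the
  identity at \<open>y\<close>, so the identities at \<open>x + y\<close> and \<open>x - y\<close> separate the linear from the
  quadratic part.
\<close>

lemma jordan_identity_linearized:
  "y \<bullet>\<^sub>J ((x \<bullet>\<^sub>J x) \<bullet>\<^sub>J z) + 2 *\<^sub>R (x \<bullet>\<^sub>J ((x \<bullet>\<^sub>J y) \<bullet>\<^sub>J z))
    = (x \<bullet>\<^sub>J x) \<bullet>\<^sub>J (y \<bullet>\<^sub>J z) + 2 *\<^sub>R ((x \<bullet>\<^sub>J y) \<bullet>\<^sub>J (x \<bullet>\<^sub>J z))"
proof -
  define p where "p = x \<bullet>\<^sub>J y"
  define D where "D = (\<lambda>u v. u \<bullet>\<^sub>J (v \<bullet>\<^sub>J z) - v \<bullet>\<^sub>J (u \<bullet>\<^sub>J z))"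
  have D0: "D w (w \<bullet>\<^sub>J w) = 0" for w
    by (simp add: D_def jordan_identity)
  have D: "D (u + u') v = D u v + D u' v" "D (u - u') v = D u v - D u' v"
    "D u (v + v') = D u v + D u v'" "D u (v - v') = D u v - D u v'" for u u' v v'
    by (simp_all add: D_def jp.add_left jp.add_right jp.diff_left jp.diff_right)
  have "(x + y) \<bullet>\<^sub>J (x + y) = x \<bullet>\<^sub>J x + p + p + y \<bullet>\<^sub>J y"
    by (simp only: jp.add_left jp.add_right commute[of y x] p_def add.assoc)
  then have plus: "D y (x \<bullet>\<^sub>J x) + D x p + D x p + D x (y \<bullet>\<^sub>J y) + D y p + D y p = 0"
    using D0[of "x + y"] by (simp add: D D0 ac_simps)
  have sq: "(x - y) \<bullet>\<^sub>J (x - y) = x \<bullet>\<^sub>J x - p - p + y \<bullet>\<^sub>J y"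
    by (simp add: jp.diff_left jp.diff_right commute[of y x] p_def)
  have minus: "D y (x \<bullet>\<^sub>J x) + D x p + D x p = D x (y \<bullet>\<^sub>J y) + D y p + D y p"
    using D0[of "x - y"] unfolding sq by (simp add: D D0 algebra_simps)
  have "2 *\<^sub>R (D y (x \<bullet>\<^sub>J x) + D x p + D x p) = 0"
    using plus minus unfolding scaleR_2 by (metis add.assoc)
  then have "D y (x \<bullet>\<^sub>J x) + D x p + D x p = 0" by simp
  then show ?thesis by (simp add: D_def p_def scaleR_2 algebra_simps)
qed

text \<open>The linearized identity with \<open>x\<close> and \<open>z\<close> both equal to
  \<open>c\<close>: multiplication by \<open>c\<close> is annihilated by
  \<open>t (2 t - 1) (t - 1)\<close>.\<close>

lemma idempotent_mult_cubic:
  assumes "c \<bullet>\<^sub>J c = c"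
  shows "2 *\<^sub>R (c \<bullet>\<^sub>J (c \<bullet>\<^sub>J (c \<bullet>\<^sub>J y))) = 3 *\<^sub>R (c \<bullet>\<^sub>J (c \<bullet>\<^sub>J y)) - c \<bullet>\<^sub>J y"
proof -
  have "c \<bullet>\<^sub>J y + 2 *\<^sub>R (c \<bullet>\<^sub>J (c \<bullet>\<^sub>J (c \<bullet>\<^sub>J y)))
      = c \<bullet>\<^sub>J (c \<bullet>\<^sub>J y) + 2 *\<^sub>R (c \<bullet>\<^sub>J (c \<bullet>\<^sub>J y))"
    using jordan_identity_linearized[of y c c] assms
    by (simp add: commute[of y c] commute[of "c \<bullet>\<^sub>J y" c])
  also have "\<dots> = (1 + 2) *\<^sub>R (c \<bullet>\<^sub>J (c \<bullet>\<^sub>J y))"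
    by (simp only: scaleR_add_left scaleR_one)
  finally show ?thesis by (simp add: algebra_simps)
qed

lemma inner_mult_swap: "inner (c \<bullet>\<^sub>J x) y = inner x (c \<bullet>\<^sub>J y)"
  using inner_assoc[of x c y] by (simp add: commute[of x c])

text \<open>
  The cubic relation confines the spectrum of multiplication by \<open>c\<close> to \<open>{0, 1/2, 1}\<close>, and on
  these three points \<open>t = 8 (t - t\<^sup>2)\<^sup>2 + (2 t\<^sup>2 - t)\<^sup>2\<close>.
\<close>

lemma idempotent_mult_psd:
  assumes "c \<bullet>\<^sub>J c = c"
  shows "0 \<le> inner (c \<bullet>\<^sub>J x) x"
proof -
  define L where "L = (\<lambda>y. c \<bullet>\<^sub>J y)"
  define m1 m2 where "m1 = inner (L x) x" and "m2 = inner (L (L x)) x"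
  have sa: "inner (L y) z = inner (L z) y" for y z
    unfolding L_def by (metis inner_mult_swap inner_commute)
  have rel: "2 * inner (L (L (L y))) z = 3 * inner (L (L y)) z - inner (L y) z" for y z
    using arg_cong[OF idempotent_mult_cubic[OF assms, of y], of "\<lambda>v. inner v z"]
    by (simp add: L_def inner_diff_left)
  have 11: "inner (L x) (L x) = m2"
    unfolding m2_def using sa[of "L x" x] by simp
  have 21: "inner (L (L x)) (L x) = inner (L (L (L x))) x"
    by (rule trans[OF inner_commute sa[of "L (L x)" x, symmetric]])
  have 12: "inner (L x) (L (L x)) = inner (L (L x)) (L x)"
    by (rule inner_commute)
  have 22: "inner (L (L x)) (L (L x)) = inner (L (L (L (L x)))) x"
    using sa[of "L x" "L (L x)"] sa[of "L (L (L x))" x] inner_commute[of "L x" "L (L (L x))"]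
    by linarith
  \<comment> \<open>\<open>rel\<close> at \<open>x\<close> and at \<open>L x\<close> eliminates the
    cubic and quartic terms in \<open>L\<close>, leaving only \<open>m1\<close> and
    \<open>m2\<close>.\<close>
  have "m1 = 8 * inner (L x - L (L x)) (L x - L (L x))
      + inner (2 *\<^sub>R L (L x) - L x) (2 *\<^sub>R L (L x) - L x)"
    using rel[of x x] rel[of "L x" x]
    by (simp add: inner_diff_left inner_diff_right 11 12 21 22 flip: m1_def m2_def)
  moreover have "\<dots> \<ge> 0" by simp
  ultimately show ?thesis by (simp add: m1_def L_def)
qed

text \<open>Associativity turns this inner product into the quadratic form of multiplication by
  \<open>c\<close> at \<open>x\<close>.\<close>

lemma inner_square_idempotent_nonneg:
  assumes "c \<bullet>\<^sub>J c = c"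
  shows "0 \<le> inner (x \<bullet>\<^sub>J x) c"
  using idempotent_mult_psd[OF assms, of x] inner_assoc[of x x c]
  by (simp add: commute[of x c] inner_commute)

lemma inner_square_unit: "inner (x \<bullet>\<^sub>J x) e = inner x x"
  using inner_assoc[of x x e] by (simp add: commute[of x e] unit)

lemma zero_in_symmetric_cone: "0 \<in> symmetric_cone (\<bullet>\<^sub>J)"
  unfolding symmetric_cone_def using jp.zero_left[of 0] by (metis (mono_tags) mem_Collect_eq)

section \<open>Jordan frames and the trace of their elements\<close>

lemma frame_elements_mult:
  assumes "jordan_frame (\<bullet>\<^sub>J) e F" "f \<in> F" "g \<in> F"
  shows "f \<bullet>\<^sub>J g = (if f = g then f else 0)"
proof (cases "f = g")
  case True
  then show ?thesis
    using assms by (simp add: jordan_frame_def primitive_idempotent_def idempotent_def)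
next
  case False
  then show ?thesis using assms by (simp add: jordan_frame_def)
qed

lemma frame_subset_sum_mult:
  assumes F: "jordan_frame (\<bullet>\<^sub>J) e F" and "T \<subseteq> F" "f \<in> F"
  shows "(\<Sum>g\<in>T. k g *\<^sub>R g) \<bullet>\<^sub>J f = (if f \<in> T then k f *\<^sub>R f else 0)"
proof -
  have "finite T" using F finite_subset[OF assms(2)] by (simp add: jordan_frame_def)
  have "(\<Sum>g\<in>T. k g *\<^sub>R g) \<bullet>\<^sub>J f = (\<Sum>g\<in>T. k g *\<^sub>R (g \<bullet>\<^sub>J f))"
    by (simp add: jp.sum_left jp.scaleR_left)
  also have "\<dots> = (\<Sum>g\<in>T. if g = f then k f *\<^sub>R f else 0)"
    using assms by (intro sum.cong) (auto simp: frame_elements_mult[OF F])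
  finally show ?thesis using \<open>finite T\<close> by simp
qed

lemma frame_subset_sum_square:
  assumes F: "jordan_frame (\<bullet>\<^sub>J) e F" and "T \<subseteq> F"
  shows "(\<Sum>g\<in>T. k g *\<^sub>R g) \<bullet>\<^sub>J (\<Sum>g\<in>T. k g *\<^sub>R g) = (\<Sum>g\<in>T. (k g)\<^sup>2 *\<^sub>R g)"
proof -
  let ?s = "\<Sum>g\<in>T. k g *\<^sub>R g"
  have "?s \<bullet>\<^sub>J ?s = (\<Sum>f\<in>T. k f *\<^sub>R (?s \<bullet>\<^sub>J f))"
    by (simp add: jp.sum_right jp.scaleR_right)
  also have "\<dots> = (\<Sum>g\<in>T. (k g)\<^sup>2 *\<^sub>R g)"
  proof (rule sum.cong[OF refl])
    fix f assume "f \<in> T"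
    then have "?s \<bullet>\<^sub>J f = k f *\<^sub>R f"
      using frame_subset_sum_mult[OF assms, of f k] assms(2) by auto
    then show "k f *\<^sub>R (?s \<bullet>\<^sub>J f) = (k f)\<^sup>2 *\<^sub>R f" by (simp add: power2_eq_square)
  qed
  finally show ?thesis .
qed

text \<open>Squaring forces every coefficient to be 0 or 1, and primitivity leaves room for a single
  1. Hence the trace of \<open>p\<close> cannot depend on the frame in which it is expanded.\<close>

lemma primitive_idempotent_coeffs_sum:
  assumes p: "primitive_idempotent (\<bullet>\<^sub>J) p" and F: "jordan_frame (\<bullet>\<^sub>J) e F"
    and eq: "p = (\<Sum>f\<in>F. l f *\<^sub>R f)"
  shows "(\<Sum>f\<in>F. l f) = 1"
proof -
  have fin: "finite F" and id: "\<And>c. c \<in> F \<Longrightarrow> c \<bullet>\<^sub>J c = c" and nz: "\<And>c. c \<in> F \<Longrightarrow> c \<noteq> 0"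
    using F unfolding jordan_frame_def primitive_idempotent_def idempotent_def by auto
  note mult = frame_subset_sum_mult[OF F]
    and square = frame_subset_sum_square[OF F]
  have l: "l f = 0 \<or> l f = 1" if "f \<in> F" for f
  proof -
    have "(\<Sum>f\<in>F. (l f)\<^sup>2 *\<^sub>R f) = (\<Sum>f\<in>F. l f *\<^sub>R f)"
      using p square[of F l] eq unfolding primitive_idempotent_def idempotent_def by simp
    \<comment> \<open>Multiplying both sums by \<open>f\<close> isolates its coefficient.\<close>
    then have "(l f)\<^sup>2 *\<^sub>R f = l f *\<^sub>R f"
      using mult[OF subset_refl that, of "\<lambda>f. (l f)\<^sup>2"] mult[OF subset_refl that, of l] that
      by metis
    then show ?thesis using nz[OF that] by (simp add: power2_eq_square)
  qed
  define S where "S = {f \<in> F. l f = 1}"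
  have SF: "S \<subseteq> F" "finite S" using fin by (auto simp: S_def)
  have "p = (\<Sum>f\<in>S. l f *\<^sub>R f)"
    unfolding eq using l fin by (intro sum.mono_neutral_right) (auto simp: S_def)
  then have pS: "p = \<Sum>S" by (simp add: S_def)
  have lS: "(\<Sum>f\<in>F. l f) = (\<Sum>f\<in>S. l f)"
    using l fin by (intro sum.mono_neutral_right) (auto simp: S_def)
  have "S \<noteq> {}" using p pS unfolding primitive_idempotent_def by auto
  then obtain f where f: "f \<in> S" by blast
  have "(\<Sum>(S - {f})) \<bullet>\<^sub>J (\<Sum>(S - {f})) = \<Sum>(S - {f})"
    using square[of "S - {f}" "\<lambda>_. 1"] SF by auto
  moreover have "p = f + \<Sum>(S - {f})"
    using pS f SF by (simp add: sum.remove)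
  \<comment> \<open>Otherwise \<open>f\<close> and the remaining sum would split \<open>p\<close>
    into two nonzero idempotents.\<close>
  ultimately have zero: "\<Sum>(S - {f}) = 0"
    using p f SF id nz unfolding primitive_idempotent_def idempotent_def by blast
  have "S - {f} = {}"
  proof (rule ccontr)
    assume "S - {f} \<noteq> {}"
    then obtain g where g: "g \<in> S - {f}" by blast
    then have "(\<Sum>(S - {f})) \<bullet>\<^sub>J g = g"
      using mult[of "S - {f}" g "\<lambda>_. 1"] SF by auto
    then show False using zero g SF nz by (auto simp: jp.zero_left)
  qed
  then have "S = {f}" using f by blast
  then show ?thesis using lS by (auto simp: S_def)
qed

lemma jordan_trace_frame_element:
  assumes F: "jordan_frame (\<bullet>\<^sub>J) e F" and p: "p \<in> F"
  shows "jordan_trace (\<bullet>\<^sub>J) e p = 1"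
  unfolding jordan_trace_def
proof (rule the_equality)
  let ?l = "\<lambda>f. if f = p then 1 else 0 :: real"
  have fin: "finite F" using F by (simp add: jordan_frame_def)
  have "(\<Sum>f\<in>F. ?l f *\<^sub>R f) = (\<Sum>f\<in>F. if f = p then p else 0)" by (rule sum.cong) auto
  then have "p = (\<Sum>f\<in>F. ?l f *\<^sub>R f)" using fin p by simp
  moreover have "1 = (\<Sum>f\<in>F. ?l f)" using fin p by simp
  ultimately show "\<exists>F l. jordan_frame (\<bullet>\<^sub>J) e F \<and> p = (\<Sum>f\<in>F. l f *\<^sub>R f) \<and> 1 = (\<Sum>f\<in>F. l f)"
    using F by (intro exI[of _ F] exI[of _ ?l]) simp
next
  have "primitive_idempotent (\<bullet>\<^sub>J) p" using F p by (simp add: jordan_frame_def)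
  then show "t = 1"
    if "\<exists>F l. jordan_frame (\<bullet>\<^sub>J) e F \<and> p = (\<Sum>f\<in>F. l f *\<^sub>R f) \<and> t = (\<Sum>f\<in>F. l f)" for t
    using that primitive_idempotent_coeffs_sum by metis
qed

text \<open>Multiplication by \<open>a\<close> is half the derivative of squaring at \<open>a\<close>.\<close>

lemma square_in_interior_symmetric_cone:
  assumes "\<And>x. a \<bullet>\<^sub>J x = 0 \<Longrightarrow> x = 0"
  shows "a \<bullet>\<^sub>J a \<in> interior (symmetric_cone (\<bullet>\<^sub>J))"
proof -
  let ?D = "\<lambda>h. a \<bullet>\<^sub>J h + h \<bullet>\<^sub>J a"
  have cont: "continuous_on UNIV (\<lambda>x. x \<bullet>\<^sub>J x)"
    by (intro jp.continuous_on continuous_on_id)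
  have der: "((\<lambda>x. x \<bullet>\<^sub>J x) has_derivative ?D) (at a)"
    by (rule jp.FDERIV[OF has_derivative_ident has_derivative_ident])
  then have lin: "linear ?D" using has_derivative_linear by blast
  have "inj ?D"
  proof (subst linear_injective_0[OF lin], intro allI impI)
    fix h assume "?D h = 0"
    then have "2 *\<^sub>R (a \<bullet>\<^sub>J h) = 0" by (simp add: commute[of h a] scaleR_2)
    then show "h = 0" using assms by simp
  qed
  then obtain g where g: "linear g" "\<And>x. ?D (g x) = x"
    using linear_injective_isomorphism[OF lin] by blast
  then have "?D \<circ> g = id" by (simp add: fun_eq_iff)
  \<comment> \<open>A right inverse of the derivative makes squaring open at
    \<open>a\<close>.\<close>
  have "a \<bullet>\<^sub>J a \<in> interior ((\<lambda>x. x \<bullet>\<^sub>J x) ` UNIV)"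
    by (rule sussmann_open_mapping[OF open_UNIV cont UNIV_I der _ \<open>?D \<circ> g = id\<close>])
       (use g in \<open>simp_all add: linear_conv_bounded_linear\<close>)
  moreover have "(\<lambda>x. x \<bullet>\<^sub>J x) ` UNIV = symmetric_cone (\<bullet>\<^sub>J)"
    by (auto simp: symmetric_cone_def)
  ultimately show ?thesis by simp
qed

end

section \<open>The maps \<open>D\<close>, here \<open>frame_coords\<close>, and
  \<open>D\<^sup>*\<close>, here \<open>frame_comb\<close>\<close>

definition frame_coords :: "('n::finite \<Rightarrow> 'v::real_inner) \<Rightarrow> 'v \<Rightarrow> real ^ 'n" where
  "frame_coords c x = (\<chi> i. inner x (c i))"

definition frame_comb :: "('n::finite \<Rightarrow> 'v::real_inner) \<Rightarrow> real ^ 'n \<Rightarrow> 'v" where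
  "frame_comb c u = (\<Sum>i\<in>UNIV. (u $ i) *\<^sub>R c i)"

lemma inner_frame_comb: "inner x (frame_comb c u) = inner (frame_coords c x) u"
  by (simp add: frame_coords_def frame_comb_def inner_sum_right inner_vec_def mult.commute)

lemma frame_comb_add: "frame_comb c (u + v) = frame_comb c u + frame_comb c v"
  by (simp add: frame_comb_def scaleR_add_left sum.distrib)

lemma frame_comb_zero [simp]: "frame_comb c 0 = 0"
  by (simp add: frame_comb_def)

lemma frame_coords_zero [simp]: "frame_coords c 0 = 0"
  by (simp add: frame_coords_def vec_eq_iff)

lemma frame_lift_eq: "frame_lift A c x = frame_comb c (A *v frame_coords c x)"
  by (simp add: frame_lift_def rank_one_op_def frame_comb_def frame_coords_def
      matrix_vector_mult_def scaleR_sum_left inner_commute)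

lemma linear_frame_lift: "linear (frame_lift A c)"
  unfolding frame_lift_def rank_one_op_def
  by (intro linearI)
     (simp_all add: inner_add_right scaleR_add_left scaleR_add_right sum.distrib
      scaleR_sum_right ac_simps)

lemma interior_nonneg_orthant_pos:
  fixes d :: "real ^ 'n"
  assumes "d \<in> interior nonneg_orthant"
  shows "0 < d $ i"
proof -
  obtain r where r: "r > 0" "ball d r \<subseteq> nonneg_orthant"
    using assms mem_interior by blast
  \<comment> \<open>Half the radius keeps the shifted point inside the ball, so \<open>d $ i\<close>
    is at least \<open>r / 2\<close>.\<close>
  have "d - (r / 2) *\<^sub>R axis i 1 \<in> ball d r"
    using r by (simp add: dist_norm)
  then have "0 \<le> (d - (r / 2) *\<^sub>R axis i 1) $ i"
    using r unfolding nonneg_orthant_def by blast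
  then show ?thesis using r by simp
qed

section \<open>The symmetric cone in frame coordinates\<close>

locale framed_euclidean_jordan_algebra = trace_euclidean_jordan_algebra +
  fixes c :: "'n::finite \<Rightarrow> 'a"
  assumes inj_frame: "inj c" and frame: "jordan_frame (\<bullet>\<^sub>J) e (range c)"
begin

abbreviation "K \<equiv> symmetric_cone (\<bullet>\<^sub>J)"

lemma frame_mult: "c i \<bullet>\<^sub>J c j = (if i = j then c i else 0)"
  using frame_elements_mult[OF frame] inj_frame by (simp add: inj_eq)

text \<open>The diagonal is the trace of a frame element; off it, write \<open>c i\<close> as its
  own square and move one factor across.\<close>

lemma frame_inner: "inner (c i) (c j) = (if i = j then 1 else 0)"
proof (cases "i = j")
  case True
  then show ?thesis
    using jordan_trace_frame_element[OF frame] by (simp add: inner_eq_trace frame_mult)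
next
  case False
  then show ?thesis
    using inner_assoc[of "c i" "c i" "c j"] by (simp add: frame_mult)
qed

lemma frame_sum: "(\<Sum>i\<in>UNIV. c i) = e"
  using frame inj_frame by (simp add: jordan_frame_def sum.reindex)

lemma frame_coords_comb: "frame_coords c (frame_comb c u) = u"
  by (simp add: frame_coords_def frame_comb_def inner_sum_left frame_inner vec_eq_iff
      if_distrib cong: if_cong)

lemma frame_comb_square:
  "frame_comb c u \<bullet>\<^sub>J frame_comb c u = frame_comb c (\<chi> i. (u $ i)\<^sup>2)"
proof -
  have mult: "frame_comb c u \<bullet>\<^sub>J c j = u $ j *\<^sub>R c j" for j
    by (simp add: frame_comb_def jp.sum_left jp.scaleR_left frame_mult if_distrib cong: if_cong)
  have "frame_comb c u \<bullet>\<^sub>J frame_comb c u = (\<Sum>j\<in>UNIV. u $ j *\<^sub>R (frame_comb c u \<bullet>\<^sub>J c j))"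
    by (subst (2) frame_comb_def) (simp add: jp.sum_right jp.scaleR_right)
  then show ?thesis by (simp add: mult) (simp add: frame_comb_def power2_eq_square)
qed

text \<open>Expand \<open>e\<close> along the frame: each \<open>c i\<close> contributes a
  nonnegative form, so raising its weight from \<open>m\<close> to \<open>u $ i\<close> cannot
  decrease the sum. A positive \<open>m\<close> makes the multiplication injective.\<close>

lemma frame_comb_mult_inner:
  assumes "\<And>i. m \<le> u $ i"
  shows "m * inner x x \<le> inner (frame_comb c u \<bullet>\<^sub>J x) x"
proof -
  have "m * inner x x = m * inner (e \<bullet>\<^sub>J x) x" by (simp add: unit)
  also have "\<dots> = (\<Sum>i\<in>UNIV. m * inner (c i \<bullet>\<^sub>J x) x)"
    unfolding frame_sum[symmetric] by (simp add: jp.sum_left inner_sum_left sum_distrib_left)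
  also have "\<dots> \<le> (\<Sum>i\<in>UNIV. u $ i * inner (c i \<bullet>\<^sub>J x) x)"
    by (intro sum_mono mult_right_mono assms idempotent_mult_psd) (simp add: frame_mult)
  also have "\<dots> = inner (frame_comb c u \<bullet>\<^sub>J x) x"
    by (simp add: frame_comb_def jp.sum_left jp.scaleR_left inner_sum_left)
  finally show ?thesis .
qed

lemma frame_coords_nonneg: "x \<in> K \<Longrightarrow> frame_coords c x \<in> nonneg_orthant"
  by (auto simp: symmetric_cone_def nonneg_orthant_def frame_coords_def frame_mult
      intro!: inner_square_idempotent_nonneg)

text \<open>The coordinates of a square sum to its inner product with \<open>e\<close>, which is the
  squared norm of the root.\<close>

lemma frame_coords_eq_0:
  assumes "x \<in> K" "frame_coords c x = 0"
  shows "x = 0"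
proof -
  obtain y where y: "x = y \<bullet>\<^sub>J y" using assms by (auto simp: symmetric_cone_def)
  have "inner x e = 0"
    using assms(2) unfolding frame_sum[symmetric]
    by (simp add: inner_sum_right frame_coords_def vec_eq_iff)
  then have "y = 0" using inner_square_unit[of y] y by simp
  then show ?thesis using y by (simp add: jp.zero_left)
qed

lemma frame_comb_in_cone_iff: "frame_comb c u \<in> K \<longleftrightarrow> u \<in> nonneg_orthant"
proof
  assume "frame_comb c u \<in> K"
  then show "u \<in> nonneg_orthant" using frame_coords_nonneg frame_coords_comb by metis
next
  assume "u \<in> nonneg_orthant"
  \<comment> \<open>Squaring acts coordinatewise on combinations of the frame, so coordinatewise
    roots give a root in the algebra.\<close>
  then have "u = (\<chi> i. ((\<chi> i. sqrt (u $ i)) $ i)\<^sup>2)"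
    by (simp add: nonneg_orthant_def vec_eq_iff)
  then have "frame_comb c u = frame_comb c (\<chi> i. sqrt (u $ i)) \<bullet>\<^sub>J frame_comb c (\<chi> i. sqrt (u $ i))"
    using frame_comb_square by metis
  then show "frame_comb c u \<in> K" by (auto simp: symmetric_cone_def)
qed

lemma frame_comb_interior:
  assumes "d \<in> interior nonneg_orthant"
  shows "frame_comb c d \<in> interior K"
proof -
  define s where "s = (\<chi> i. sqrt (d $ i))"
  define m where "m = Min (range (\<lambda>i. s $ i))"
  have pos: "0 < d $ i" for i by (rule interior_nonneg_orthant_pos[OF assms])
  have m: "0 < m" and le: "\<And>i. m \<le> s $ i"
    using pos by (auto simp: m_def s_def)
  have "x = 0" if "frame_comb c s \<bullet>\<^sub>J x = 0" for x
  proof -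
    have "m * inner x x \<le> 0" using frame_comb_mult_inner[OF le, of x] that by simp
    then show ?thesis using m by (metis inner_gt_zero_iff mult_pos_pos not_less)
  qed
  then have "frame_comb c s \<bullet>\<^sub>J frame_comb c s \<in> interior K"
    by (rule square_in_interior_symmetric_cone)
  moreover have "(\<chi> i. (s $ i)\<^sup>2) = d"
    using pos by (simp add: s_def vec_eq_iff less_imp_le)
  ultimately show ?thesis by (simp add: frame_comb_square)
qed

section \<open>Transport of copositivity and complementarity\<close>

lemma inner_frame_lift:
  "inner (frame_lift A c x) x = inner (A *v frame_coords c x) (frame_coords c x)"
  by (metis frame_lift_eq inner_frame_comb inner_commute)

text \<open>With \<open>q\<close> lifted too, the dual variable is \<open>D\<^sup>*\<close> of the
  one for \<open>A\<close>; adjointness then matches the orthogonality conditions.\<close>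

lemma frame_lift_lcp_iff:
  "x \<in> lcp_solutions (frame_lift A c) K (frame_comb c q) \<longleftrightarrow>
     x \<in> K \<and> frame_coords c x \<in> lcp_solutions ((*v) A) nonneg_orthant q"
  using frame_coords_nonneg
  by (auto simp: lcp_solutions_def frame_lift_eq frame_comb_in_cone_iff inner_frame_comb
      simp flip: frame_comb_add)

lemma frame_comb_lcp_iff:
  "frame_comb c u \<in> lcp_solutions (frame_lift A c) K (frame_comb c q) \<longleftrightarrow>
     u \<in> lcp_solutions ((*v) A) nonneg_orthant q"
  unfolding frame_lift_lcp_iff frame_coords_comb frame_comb_in_cone_iff
  by (auto simp: lcp_solutions_def)

text \<open>Uniqueness passes both ways because \<open>D\<^sup>*\<close> is injective and
  \<open>D\<close> kills no nonzero element of \<open>K\<close>.\<close>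

lemma frame_lift_lcp_trivial_iff:
  "lcp_solutions (frame_lift A c) K (frame_comb c q) = {0} \<longleftrightarrow>
     lcp_solutions ((*v) A) nonneg_orthant q = {0}"  (is "?S = {0} \<longleftrightarrow> ?T = {0}")
proof
  assume S: "?S = {0}"
  have "u = 0" if "u \<in> ?T" for u
  proof -
    have "frame_comb c u = 0" using that S frame_comb_lcp_iff by blast
    then show ?thesis using frame_coords_comb[of u] by simp
  qed
  moreover have "0 \<in> ?T" using S frame_lift_lcp_iff[of 0 A q] by simp
  ultimately show "?T = {0}" by blast
next
  assume "?T = {0}"
  then show "?S = {0}"
    using frame_lift_lcp_iff[of _ A q] frame_coords_eq_0 zero_in_symmetric_cone by auto
qed

text \<open>\<open>D\<close> maps \<open>K\<close> onto the orthant, so both quadratic forms take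
  the same values.\<close>

lemma copositive_frame_lift_iff:
  "copositive_on nonneg_orthant ((*v) A) \<longleftrightarrow> copositive_on K (frame_lift A c)"
  unfolding copositive_on_def inner_frame_lift
  by (metis frame_coords_nonneg frame_comb_in_cone_iff frame_coords_comb)

lemma strictly_copositive_frame_lift_iff:
  "strictly_copositive_on nonneg_orthant ((*v) A) \<longleftrightarrow> strictly_copositive_on K (frame_lift A c)"
  unfolding strictly_copositive_on_def inner_frame_lift
  by (metis frame_coords_nonneg frame_comb_in_cone_iff frame_coords_comb frame_coords_eq_0
      frame_coords_zero)

lemma R0_frame_lift_iff:
  "(*v) A \<in> R0_class nonneg_orthant \<longleftrightarrow> frame_lift A c \<in> R0_class K"
  using frame_lift_lcp_trivial_iff[of A 0] by (simp add: R0_class_def linear_frame_lift)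

text \<open>The witness \<open>d\<close> is lifted by \<open>D\<^sup>*\<close>. This argument does
  not reverse: an interior point of \<open>K\<close> need not be a combination of the frame.\<close>

lemma R_frame_lift:
  assumes "(*v) A \<in> R_class nonneg_orthant"
  shows "frame_lift A c \<in> R_class K"
proof -
  obtain d where "d \<in> interior nonneg_orthant"
    and "lcp_solutions ((*v) A) nonneg_orthant 0 = {0}"
    and "lcp_solutions ((*v) A) nonneg_orthant d = {0}"
    using assms by (auto simp: R_class_def)
  then show ?thesis
    using frame_lift_lcp_trivial_iff[of A 0] frame_lift_lcp_trivial_iff[of A d]
      frame_comb_interior[of d]
    by (auto simp: R_class_def linear_frame_lift)
qed

text \<open>Solve the lifted problem for \<open>frame_comb c q\<close> and apply \<open>D\<close> to
  the solution.\<close>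

lemma Q_frame_lift:
  assumes "frame_lift A c \<in> Q_class K"
  shows "(*v) A \<in> Q_class nonneg_orthant"
proof -
  have "lcp_solutions ((*v) A) nonneg_orthant q \<noteq> {}" for q
    using assms frame_lift_lcp_iff[of _ A q] unfolding Q_class_def by blast
  then show ?thesis by (simp add: Q_class_def)
qed

end

theorem theorem10p3:
  fixes jp :: "'v::euclidean_space \<Rightarrow> 'v \<Rightarrow> 'v"
    and e :: 'v
    and c :: "'n::finite \<Rightarrow> 'v"
    and A :: "real ^ 'n ^ 'n"
  assumes "trace_euclidean_jordan_algebra jp e"
    and "jordan_rank jp e = CARD('n)"
    and "inj c" and "jordan_frame jp e (range c)"
  shows
    "(copositive_on nonneg_orthant ((*v) A) \<longleftrightarrow>
        copositive_on (symmetric_cone jp) (frame_lift A c)) \<and>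
     (strictly_copositive_on nonneg_orthant ((*v) A) \<longleftrightarrow>
        strictly_copositive_on (symmetric_cone jp) (frame_lift A c)) \<and>
     ((*v) A \<in> R0_class nonneg_orthant \<longleftrightarrow> frame_lift A c \<in> R0_class (symmetric_cone jp)) \<and>
     ((*v) A \<in> R_class nonneg_orthant \<longrightarrow> frame_lift A c \<in> R_class (symmetric_cone jp)) \<and>
     (frame_lift A c \<in> Q_class (symmetric_cone jp) \<longrightarrow> (*v) A \<in> Q_class nonneg_orthant)"
proof -
  interpret framed_euclidean_jordan_algebra jp e c
    using assms(1,3,4)
    by (simp add: framed_euclidean_jordan_algebra_def framed_euclidean_jordan_algebra_axioms_def)
  show ?thesis
    using copositive_frame_lift_iff strictly_copositive_frame_lift_iff R0_frame_lift_iff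
      R_frame_lift Q_frame_lift by blast
qed

end
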